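(* Let $M\in SN$ be a typed term and let $\sigma=[x_i:=N_i\mid i=1,\dots,n]$ be a substitution of intuitionistic variables such that the substituted variables $x_1,\dots,x_n$ all have the same type $A$, each $N_i$ is a typed term of type $A$, and $N_i\in SN$ for all $i$. Then $M[\sigma]\in SN$.
   Context: Formulas: atoms, $\perp$, $\rightarrow,\wedge,\vee$; $\neg A=A\rightarrow\perp$. Intuitionistic variables $x,y,\dots$, classical variables $a,b,\dots$. Terms: ${\cal T} ::= x \mid \lambda x\, {\cal T} \mid ({\cal T}\ {\cal E}) \mid \langle {\cal T},{\cal T}\rangle \mid \omega_1 {\cal T} \mid \omega_2 {\cal T} \mid \mu a\, {\cal T} \mid (a\ {\cal T})$, ${\cal E} ::= {\cal T} \mid \pi_1 \mid \pi_2 \mid [x.{\cal T}, y.{\cal T}]$. Typing (contexts contain $x:A$, $a:\neg A$): $x:A$ for declared $x$; $\langle M,N\rangle:A\wedge B$ from $M:A,N:B$; $(M\ \pi_i):A_i$ from $M:A_1\wedge A_2$; $\lambda xM:A\rightarrow B$ from $M:B$ under $x:A$; $(M\ N):B$ from $M:A\rightarrow B,N:A$; $\omega_iM:A_1\vee A_2$ from $M:A_i$; $(M\ [x_1.N_1,x_2.N_2]):C$ from $M:A_1\vee A_2$ and $N_i:C$ under $x_i:A_i$; $\mu aM:A$ from $M:\perp$ under $a:\neg A$; $(a\ M):\perp$ from $M:A$ under $a:\neg A$. Typed = has a type in some context. Reduction $\triangleright$: compatible closure of $(\lambda x M\ N)\triangleright M[x:=N]$; $(\langle M_1,M_2\rangle\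 \pi_i)\triangleright M_i$; $(\omega_i M\ [x_1.N_1,x_2.N_2])\triangleright N_i[x_i:=M]$; $(M\ [x_1.N_1,x_2.N_2]\ \varepsilon)\triangleright (M\ [x_1.(N_1\ \varepsilon),x_2.(N_2\ \varepsilon)])$; $(\mu a M\ \varepsilon)\triangleright \mu a\, M[a:=^*\varepsilon]$ ($M[a:=^*\varepsilon]$ replaces each subterm $(a\ P)$ by $(a\ (P\ \varepsilon))$). $SN$: no infinite reduction sequence. $M[\sigma]$ is simultaneous capture-avoiding substitution. *)

theory Defs imports Main begin

datatype 'p form =
    Atom 'p
  | Bot
  | Imp "'p form" "'p form"
  | Conj "'p form" "'p form"
  | Disj "'p form" "'p form"

text \<open>
  Terms up to \<open>\<alpha>\<close>-equivalence, in de Bruijn style with two independent families of indices: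
  intuitionistic variables (bound by \<^term>\<open>Lam\<close> and, one in each branch, by \<^term>\<open>Case\<close>) and
  classical variables (bound by \<^term>\<open>Mu\<close>).  An index pointing beyond all its binders is a free
  variable.
  \<open>App M E\<close> is \<open>(M E)\<close>, \<open>Name a M\<close> is \<open>(a M)\<close>, and \<open>Case N1 N2\<close> is \<open>[x1.N1, x2.N2]\<close>.
\<close>

datatype trm =
    Var nat
  | Lam trm
  | App trm elt
  | Tup trm trm
  | In1 trm
  | In2 trm
  | Mu trm
  | Name nat trm
and elt =
    Arg trm
  | Pi1
  | Pi2
  | Case trm trm

text \<open>
  In \<open>has_type \<Gamma> \<Delta> M A\<close>, entry \<open>x\<close> of \<open>\<Gamma>\<close> is the type of the free intuitionistic variable \<open>x\<close>;
  entry \<open>a\<close> of \<open>\<Delta>\<close> is the formula \<open>C\<close> such that \<open>a : \<not>C\<close>.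
\<close>

inductive has_type :: "'p form list \<Rightarrow> 'p form list \<Rightarrow> trm \<Rightarrow> 'p form \<Rightarrow> bool" where
  ty_var: "x < length \<Gamma> \<Longrightarrow> has_type \<Gamma> \<Delta> (Var x) (\<Gamma> ! x)"
| ty_tup: "has_type \<Gamma> \<Delta> M A \<Longrightarrow> has_type \<Gamma> \<Delta> N B \<Longrightarrow> has_type \<Gamma> \<Delta> (Tup M N) (Conj A B)"
| ty_pi1: "has_type \<Gamma> \<Delta> M (Conj A B) \<Longrightarrow> has_type \<Gamma> \<Delta> (App M Pi1) A"
| ty_pi2: "has_type \<Gamma> \<Delta> M (Conj A B) \<Longrightarrow> has_type \<Gamma> \<Delta> (App M Pi2) B"
| ty_lam: "has_type (A # \<Gamma>) \<Delta> M B \<Longrightarrow> has_type \<Gamma> \<Delta> (Lam M) (Imp A B)"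
| ty_app: "has_type \<Gamma> \<Delta> M (Imp A B) \<Longrightarrow> has_type \<Gamma> \<Delta> N A \<Longrightarrow> has_type \<Gamma> \<Delta> (App M (Arg N)) B"
| ty_in1: "has_type \<Gamma> \<Delta> M A \<Longrightarrow> has_type \<Gamma> \<Delta> (In1 M) (Disj A B)"
| ty_in2: "has_type \<Gamma> \<Delta> M B \<Longrightarrow> has_type \<Gamma> \<Delta> (In2 M) (Disj A B)"
| ty_case: "has_type \<Gamma> \<Delta> M (Disj A B) \<Longrightarrow> has_type (A # \<Gamma>) \<Delta> N1 C \<Longrightarrow> has_type (B # \<Gamma>) \<Delta> N2 C
    \<Longrightarrow> has_type \<Gamma> \<Delta> (App M (Case N1 N2)) C"
| ty_mu: "has_type \<Gamma> (A # \<Delta>) M Bot \<Longrightarrow> has_type \<Gamma> \<Delta> (Mu M) A"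
| ty_name: "a < length \<Delta> \<Longrightarrow> has_type \<Gamma> \<Delta> M (\<Delta> ! a) \<Longrightarrow> has_type \<Gamma> \<Delta> (Name a M) Bot"

text \<open>Renaming of free variables: \<open>r\<close> acts on intuitionistic variables, \<open>s\<close> on classical ones.\<close>

definition up :: "(nat \<Rightarrow> nat) \<Rightarrow> nat \<Rightarrow> nat" where
  "up r = case_nat 0 (\<lambda>x. Suc (r x))"

primrec rename :: "(nat \<Rightarrow> nat) \<Rightarrow> (nat \<Rightarrow> nat) \<Rightarrow> trm \<Rightarrow> trm"
  and rename_elt :: "(nat \<Rightarrow> nat) \<Rightarrow> (nat \<Rightarrow> nat) \<Rightarrow> elt \<Rightarrow> elt" where
  "rename r s (Var x) = Var (r x)"
| "rename r s (Lam M) = Lam (rename (up r) s M)"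
| "rename r s (App M E) = App (rename r s M) (rename_elt r s E)"
| "rename r s (Tup M N) = Tup (rename r s M) (rename r s N)"
| "rename r s (In1 M) = In1 (rename r s M)"
| "rename r s (In2 M) = In2 (rename r s M)"
| "rename r s (Mu M) = Mu (rename r (up s) M)"
| "rename r s (Name a M) = Name (s a) (rename r s M)"
| "rename_elt r s (Arg N) = Arg (rename r s N)"
| "rename_elt r s Pi1 = Pi1"
| "rename_elt r s Pi2 = Pi2"
| "rename_elt r s (Case N1 N2) = Case (rename (up r) s N1) (rename (up r) s N2)"

text \<open>Simultaneous capture-avoiding substitution for intuitionistic variables.\<close>

definition up_sub :: "(nat \<Rightarrow> trm) \<Rightarrow> nat \<Rightarrow> trm" where
  "up_sub \<tau> = case_nat (Var 0) (\<lambda>x. rename Suc id (\<tau> x))"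

primrec sub :: "(nat \<Rightarrow> trm) \<Rightarrow> trm \<Rightarrow> trm"
  and sub_elt :: "(nat \<Rightarrow> trm) \<Rightarrow> elt \<Rightarrow> elt" where
  "sub \<tau> (Var x) = \<tau> x"
| "sub \<tau> (Lam M) = Lam (sub (up_sub \<tau>) M)"
| "sub \<tau> (App M E) = App (sub \<tau> M) (sub_elt \<tau> E)"
| "sub \<tau> (Tup M N) = Tup (sub \<tau> M) (sub \<tau> N)"
| "sub \<tau> (In1 M) = In1 (sub \<tau> M)"
| "sub \<tau> (In2 M) = In2 (sub \<tau> M)"
| "sub \<tau> (Mu M) = Mu (sub (\<lambda>x. rename id Suc (\<tau> x)) M)"
| "sub \<tau> (Name a M) = Name a (sub \<tau> M)"
| "sub_elt \<tau> (Arg N) = Arg (sub \<tau> N)"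
| "sub_elt \<tau> Pi1 = Pi1"
| "sub_elt \<tau> Pi2 = Pi2"
| "sub_elt \<tau> (Case N1 N2) = Case (sub (up_sub \<tau>) N1) (sub (up_sub \<tau>) N2)"

text \<open>
  \<open>M[\<sigma>]\<close> for \<open>\<sigma> = [x\<^sub>i := N\<^sub>i]\<close> given as the partial map sending each \<open>x\<^sub>i\<close> to \<open>N\<^sub>i\<close>.  The \<open>x\<^sub>i\<close> are
  free variables, so no index of \<open>M\<close> is shifted down, in contrast to \<open>inst\<close> below.
\<close>

definition msub :: "(nat \<rightharpoonup> trm) \<Rightarrow> trm \<Rightarrow> trm" where
  "msub \<sigma> M = sub (\<lambda>x. case \<sigma> x of None \<Rightarrow> Var x | Some N \<Rightarrow> N) M"

text \<open>\<open>inst N M\<close> is \<open>M[x := N]\<close> for the variable \<open>x\<close> of the binder that has just been removed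
  from around \<open>M\<close> (index \<open>0\<close>).\<close>

definition inst :: "trm \<Rightarrow> trm \<Rightarrow> trm" where
  "inst N M = sub (case_nat N Var) M"

text \<open>\<open>csub a E M\<close> is \<open>M[a :=* E]\<close>; the variable \<open>a\<close> remains in the result.\<close>

primrec csub :: "nat \<Rightarrow> elt \<Rightarrow> trm \<Rightarrow> trm"
  and csub_elt :: "nat \<Rightarrow> elt \<Rightarrow> elt \<Rightarrow> elt" where
  "csub a E (Var x) = Var x"
| "csub a E (Lam M) = Lam (csub a (rename_elt Suc id E) M)"
| "csub a E (App M F) = App (csub a E M) (csub_elt a E F)"
| "csub a E (Tup M N) = Tup (csub a E M) (csub a E N)"
| "csub a E (In1 M) = In1 (csub a E M)"
| "csub a E (In2 M) = In2 (csub a E M)"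
| "csub a E (Mu M) = Mu (csub (Suc a) (rename_elt id Suc E) M)"
| "csub a E (Name b M) =
    (if b = a then Name b (App (csub a E M) E) else Name b (csub a E M))"
| "csub_elt a E (Arg N) = Arg (csub a E N)"
| "csub_elt a E Pi1 = Pi1"
| "csub_elt a E Pi2 = Pi2"
| "csub_elt a E (Case N1 N2) =
    Case (csub a (rename_elt Suc id E) N1) (csub a (rename_elt Suc id E) N2)"

inductive red :: "trm \<Rightarrow> trm \<Rightarrow> bool" and red_elt :: "elt \<Rightarrow> elt \<Rightarrow> bool" where
  red_beta: "red (App (Lam M) (Arg N)) (inst N M)"
| red_pi1: "red (App (Tup M1 M2) Pi1) M1"
| red_pi2: "red (App (Tup M1 M2) Pi2) M2"
| red_in1: "red (App (In1 M) (Case N1 N2)) (inst M N1)"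
| red_in2: "red (App (In2 M) (Case N1 N2)) (inst M N2)"
| red_perm: "red (App (App M (Case N1 N2)) E)
    (App M (Case (App N1 (rename_elt Suc id E)) (App N2 (rename_elt Suc id E))))"
| red_mu: "red (App (Mu M) E) (Mu (csub 0 (rename_elt id Suc E) M))"
| red_Lam: "red M M' \<Longrightarrow> red (Lam M) (Lam M')"
| red_App1: "red M M' \<Longrightarrow> red (App M E) (App M' E)"
| red_App2: "red_elt E E' \<Longrightarrow> red (App M E) (App M E')"
| red_Tup1: "red M M' \<Longrightarrow> red (Tup M N) (Tup M' N)"
| red_Tup2: "red N N' \<Longrightarrow> red (Tup M N) (Tup M N')"
| red_In1: "red M M' \<Longrightarrow> red (In1 M) (In1 M')"
| red_In2: "red M M' \<Longrightarrow> red (In2 M) (In2 M')"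
| red_Mu: "red M M' \<Longrightarrow> red (Mu M) (Mu M')"
| red_Name: "red M M' \<Longrightarrow> red (Name a M) (Name a M')"
| red_Arg: "red N N' \<Longrightarrow> red_elt (Arg N) (Arg N')"
| red_Case1: "red N1 N1' \<Longrightarrow> red_elt (Case N1 N2) (Case N1' N2)"
| red_Case2: "red N2 N2' \<Longrightarrow> red_elt (Case N1 N2) (Case N1 N2')"

definition SN :: "trm set" where
  "SN = {M. \<not> (\<exists>f :: nat \<Rightarrow> trm. f 0 = M \<and> (\<forall>i. red (f i) (f (Suc i))))}"

end

theory Submission imports Defs begin

text \<open>
  Every typed term is strongly normalizing, by orthogonality.  A formula \<open>A\<close> is interpreted by a
  set of stacks of eliminations, and a term realizes \<open>A\<close> if it is SN against each of these
  stacks.  The stacks for a disjunction are the \<open>[x.N1, y.N2] E\<close> such that \<open>(N1[x:=P] E)\<close> and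
  \<open>(N2[y:=Q] E)\<close> are SN for all realizers \<open>P\<close>, \<open>Q\<close> of the disjuncts, with no condition on \<open>E\<close>
  alone: a permutative conversion moves part of \<open>E\<close> into the branches and changes neither of
  these two terms.  Variables are realizers, so realizers are closed under substitution into
  typed terms, whatever the contexts in which the realizers are typed.
\<close>

section \<open>Stacks of eliminations, and parallel substitution for both kinds of variables\<close>

definition apps :: "trm \<Rightarrow> elt list \<Rightarrow> trm" where
  "apps = foldl App"

lemma apps_simps [simp]: "apps M [] = M" "apps M (E # Es) = apps (App M E) Es"
  by (simp_all add: apps_def)

lemma apps_append: "apps M (Es @ Fs) = apps (apps M Es) Fs"
  by (simp add: apps_def)

abbreviation lift_I :: "elt \<Rightarrow> elt" where "lift_I \<equiv> rename_elt Suc id"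
abbreviation lift_C :: "elt \<Rightarrow> elt" where "lift_C \<equiv> rename_elt id Suc"

definition up_I :: "(nat \<Rightarrow> nat \<times> elt list) \<Rightarrow> nat \<Rightarrow> nat \<times> elt list" where
  "up_I \<theta> a = map_prod id (map lift_I) (\<theta> a)"

text \<open>The variable of the \<open>Mu\<close> just crossed is left alone: it is its own target,
  with an empty stack.\<close>

definition up_C :: "(nat \<Rightarrow> nat \<times> elt list) \<Rightarrow> nat \<Rightarrow> nat \<times> elt list" where
  "up_C \<theta> = case_nat (0, []) (\<lambda>a. map_prod Suc (map lift_C) (\<theta> a))"

lemma fst_up_I: "fst (up_I \<theta> a) = fst (\<theta> a)"
  and snd_up_I: "snd (up_I \<theta> a) = map lift_I (snd (\<theta> a))"
  by (simp_all add: up_I_def)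

text \<open>
  \<open>\<theta> a = (b, E)\<close> replaces each \<open>(a P)\<close> by \<open>(b (P E))\<close>.  Renamings, both substitutions of the
  calculus and the valuations of the adequacy theorem are all of this form.
\<close>

primrec psub :: "(nat \<Rightarrow> trm) \<Rightarrow> (nat \<Rightarrow> nat \<times> elt list) \<Rightarrow> trm \<Rightarrow> trm"
  and psub_elt :: "(nat \<Rightarrow> trm) \<Rightarrow> (nat \<Rightarrow> nat \<times> elt list) \<Rightarrow> elt \<Rightarrow> elt" where
  "psub \<tau> \<theta> (Var x) = \<tau> x"
| "psub \<tau> \<theta> (Lam M) = Lam (psub (up_sub \<tau>) (up_I \<theta>) M)"
| "psub \<tau> \<theta> (App M E) = App (psub \<tau> \<theta> M) (psub_elt \<tau> \<theta> E)"
| "psub \<tau> \<theta> (Tup M N) = Tup (psub \<tau> \<theta> M) (psub \<tau> \<theta> N)"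
| "psub \<tau> \<theta> (In1 M) = In1 (psub \<tau> \<theta> M)"
| "psub \<tau> \<theta> (In2 M) = In2 (psub \<tau> \<theta> M)"
| "psub \<tau> \<theta> (Mu M) = Mu (psub (\<lambda>x. rename id Suc (\<tau> x)) (up_C \<theta>) M)"
| "psub \<tau> \<theta> (Name a M) = Name (fst (\<theta> a)) (apps (psub \<tau> \<theta> M) (snd (\<theta> a)))"
| "psub_elt \<tau> \<theta> (Arg N) = Arg (psub \<tau> \<theta> N)"
| "psub_elt \<tau> \<theta> Pi1 = Pi1"
| "psub_elt \<tau> \<theta> Pi2 = Pi2"
| "psub_elt \<tau> \<theta> (Case N1 N2) =
    Case (psub (up_sub \<tau>) (up_I \<theta>) N1) (psub (up_sub \<tau>) (up_I \<theta>) N2)"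

abbreviation no_stack :: "nat \<Rightarrow> nat \<times> elt list" where
  "no_stack a \<equiv> (a, [])"

section \<open>Composition laws for renaming and parallel substitution\<close>

lemma rename_apps: "rename r s (apps M Es) = apps (rename r s M) (map (rename_elt r s) Es)"
  by (induction Es arbitrary: M) auto

lemma psub_apps: "psub \<tau> \<theta> (apps M Es) = apps (psub \<tau> \<theta> M) (map (psub_elt \<tau> \<theta>) Es)"
  by (induction Es arbitrary: M) auto

lemma up_id: "up (\<lambda>x. x) = (\<lambda>x. x)"
  by (auto simp: up_def fun_eq_iff split: nat.split)

lemma up_comp: "up r \<circ> up r' = up (r \<circ> r')"
  by (auto simp: up_def fun_eq_iff split: nat.split)

lemma up_Suc: "up r \<circ> Suc = Suc \<circ> r"
  by (auto simp: up_def)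

lemma rename_rename:
  "rename r s (rename r' s' M) = rename (r \<circ> r') (s \<circ> s') M"
  "rename_elt r s (rename_elt r' s' E) = rename_elt (r \<circ> r') (s \<circ> s') E"
  by (induction M and E arbitrary: r s r' s' and r s r' s') (simp_all add: up_comp)

lemma map_rename_rename:
  "map (rename_elt r s) \<circ> map (rename_elt r' s') = map (rename_elt (r \<circ> r') (s \<circ> s'))"
  by (auto simp: rename_rename)

lemma up_sub_up: "up_sub \<tau> \<circ> up r = up_sub (\<tau> \<circ> r)"
  by (auto simp: up_sub_def up_def fun_eq_iff split: nat.split)

lemma up_C_up: "up_C \<theta> \<circ> up s = up_C (\<theta> \<circ> s)"
  by (auto simp: up_C_def up_def fun_eq_iff split: nat.split)

lemma up_I_comp: "up_I \<theta> \<circ> s = up_I (\<theta> \<circ> s)"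
  by (auto simp: up_I_def)

lemma psub_rename:
  "psub \<tau> \<theta> (rename r s M) = psub (\<tau> \<circ> r) (\<theta> \<circ> s) M"
  "psub_elt \<tau> \<theta> (rename_elt r s E) = psub_elt (\<tau> \<circ> r) (\<theta> \<circ> s) E"
  by (induction M and E arbitrary: \<tau> \<theta> r s and \<tau> \<theta> r s)
    (simp_all add: up_sub_up up_C_up up_I_comp, simp_all add: comp_def)

lemma up_sub_rename:
  "(\<lambda>x. rename (up r) s (up_sub \<tau> x)) = up_sub (\<lambda>x. rename r s (\<tau> x))"
  by (auto simp: up_sub_def up_def fun_eq_iff rename_rename comp_def split: nat.split)

lemma up_I_rename:
  "(\<lambda>a. map_prod s (map (rename_elt (up r) s)) (up_I \<theta> a))
    = up_I (\<lambda>a. map_prod s (map (rename_elt r s)) (\<theta> a))"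
  by (auto simp: up_I_def fun_eq_iff prod.map_comp map_rename_rename up_Suc rename_rename map_prod_def split: prod.splits)

lemma up_C_rename:
  "(\<lambda>a. map_prod (up s) (map (rename_elt r (up s))) (up_C \<theta> a))
    = up_C (\<lambda>a. map_prod s (map (rename_elt r s)) (\<theta> a))"
  by (auto simp: up_C_def fun_eq_iff rename_rename up_Suc map_prod_def split: prod.splits nat.split)
    (auto simp: up_def)

lemma rename_psub:
  "rename r s (psub \<tau> \<theta> M)
    = psub (\<lambda>x. rename r s (\<tau> x)) (\<lambda>a. map_prod s (map (rename_elt r s)) (\<theta> a)) M"
  "rename_elt r s (psub_elt \<tau> \<theta> E)
    = psub_elt (\<lambda>x. rename r s (\<tau> x)) (\<lambda>a. map_prod s (map (rename_elt r s)) (\<theta> a)) E"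
  by (induction M and E arbitrary: \<tau> \<theta> r s and \<tau> \<theta> r s)
    (simp_all add: up_sub_rename up_I_rename up_C_rename rename_apps rename_rename,
     simp_all add: rename_rename up_Suc flip: up_C_rename)

text \<open>Effect of a second substitution on an entry \<open>(b, Es)\<close> of a first one. In
  \<open>(b (P Es))\<close> the name \<open>b\<close> is replaced as well, so the stack that
  \<theta> attaches to \<open>b\<close> comes behind the image of \<open>Es\<close>.\<close>

definition comp_st ::
  "(nat \<Rightarrow> trm) \<Rightarrow> (nat \<Rightarrow> nat \<times> elt list) \<Rightarrow> nat \<times> elt list \<Rightarrow> nat \<times> elt list" where
  "comp_st \<tau> \<theta> p = (fst (\<theta> (fst p)), map (psub_elt \<tau> \<theta>) (snd p) @ snd (\<theta> (fst p)))"

lemma psub_up_rename_I: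
  "psub (up_sub \<tau>) (up_I \<theta>) (rename Suc id M) = rename Suc id (psub \<tau> \<theta> M)"
  "psub_elt (up_sub \<tau>) (up_I \<theta>) (lift_I E) = lift_I (psub_elt \<tau> \<theta> E)"
  by (simp_all add: psub_rename rename_psub up_sub_def up_I_def comp_def)

lemma psub_up_rename_C:
  "psub (\<lambda>x. rename id Suc (\<tau> x)) (up_C \<theta>) (rename id Suc M) = rename id Suc (psub \<tau> \<theta> M)"
  "psub_elt (\<lambda>x. rename id Suc (\<tau> x)) (up_C \<theta>) (lift_C E) = lift_C (psub_elt \<tau> \<theta> E)"
  by (simp_all add: psub_rename rename_psub up_C_def comp_def)

lemma up_sub_psub:
  "(\<lambda>x. psub (up_sub \<tau>) (up_I \<theta>) (up_sub \<tau>' x)) = up_sub (\<lambda>x. psub \<tau> \<theta> (\<tau>' x))"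
  by (rule ext, rename_tac x, case_tac x)
    (simp_all add: up_sub_def psub_up_rename_I[unfolded up_sub_def])

lemma up_I_psub:
  "(\<lambda>a. comp_st (up_sub \<tau>) (up_I \<theta>) (up_I \<theta>' a)) = up_I (\<lambda>a. comp_st \<tau> \<theta> (\<theta>' a))"
  by (auto simp: comp_st_def fst_up_I snd_up_I psub_up_rename_I intro!: prod_eqI)

lemma up_C_psub:
  "(\<lambda>a. comp_st (\<lambda>x. rename id Suc (\<tau> x)) (up_C \<theta>) (up_C \<theta>' a))
    = up_C (\<lambda>a. comp_st \<tau> \<theta> (\<theta>' a))"
  by (rule ext, rename_tac a, case_tac a)
    (simp_all add: comp_st_def up_C_def psub_up_rename_C[unfolded up_C_def])

text \<open>Under a binder both substitutions are shifted, and a shift is a renaming; hence the laws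
  that mix \<open>psub\<close> with \<open>rename\<close> have to come first.\<close>

lemma psub_psub:
  "psub \<tau> \<theta> (psub \<tau>' \<theta>' M) = psub (\<lambda>x. psub \<tau> \<theta> (\<tau>' x)) (\<lambda>a. comp_st \<tau> \<theta> (\<theta>' a)) M"
  "psub_elt \<tau> \<theta> (psub_elt \<tau>' \<theta>' E)
    = psub_elt (\<lambda>x. psub \<tau> \<theta> (\<tau>' x)) (\<lambda>a. comp_st \<tau> \<theta> (\<theta>' a)) E"
  by (induction M and E arbitrary: \<tau> \<theta> \<tau>' \<theta>' and \<tau> \<theta> \<tau>' \<theta>')
    (simp_all add: up_sub_psub up_I_psub up_C_psub psub_up_rename_C psub_apps apps_append,
     simp_all add: comp_st_def apps_append)

section \<open>Renaming and the substitutions of the calculus as instances of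
  \<open>psub\<close>\<close>

lemma up_sub_Var_comp: "up_sub (\<lambda>x. Var (r x)) = (\<lambda>x. Var (up r x))"
  by (auto simp: up_sub_def up_def fun_eq_iff split: nat.split)

lemma up_I_no_stack: "up_I (\<lambda>a. (s a, [])) = (\<lambda>a. (s a, []))"
  by (auto simp: up_I_def)

lemma up_C_no_stack: "up_C (\<lambda>a. (s a, [])) = (\<lambda>a. (up s a, []))"
  by (auto simp: up_C_def up_def fun_eq_iff split: nat.split)

lemma rename_eq_psub:
  "rename r s M = psub (\<lambda>x. Var (r x)) (\<lambda>a. (s a, [])) M"
  "rename_elt r s E = psub_elt (\<lambda>x. Var (r x)) (\<lambda>a. (s a, [])) E"
  by (induction M and E arbitrary: r s and r s)
    (simp_all add: up_sub_Var_comp up_I_no_stack up_C_no_stack)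

lemma rename_id: "rename id id M = M" "rename_elt id id E = E"
  by (induction M and E) (simp_all add: id_def up_id)

lemma psub_Var: "psub Var no_stack M = M" "psub_elt Var no_stack E = E"
  using rename_eq_psub[of id id] rename_id by (simp_all add: id_def)

lemma sub_eq_psub: "sub \<tau> M = psub \<tau> no_stack M" "sub_elt \<tau> E = psub_elt \<tau> no_stack E"
proof (induction M and E arbitrary: \<tau> and \<tau>)
  case (Mu M)
  show ?case using Mu up_C_no_stack[of id] by (simp add: id_def up_id)
qed (simp_all add: up_I_no_stack)

lemma up_sub_Var: "up_sub Var = Var"
  using up_sub_Var_comp[of id] by (simp add: id_def up_id)

definition single :: "nat \<Rightarrow> elt \<Rightarrow> nat \<Rightarrow> nat \<times> elt list" where
  "single a E b = (b, if b = a then [E] else [])"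

lemma up_I_single: "up_I (single a E) = single a (lift_I E)"
  by (auto simp: up_I_def single_def)

lemma up_C_single: "up_C (single a E) = single (Suc a) (lift_C E)"
  by (auto simp: up_C_def single_def fun_eq_iff split: nat.split)

lemma csub_eq_psub:
  "csub a E M = psub Var (single a E) M" "csub_elt a E F = psub_elt Var (single a E) F"
  by (induction M and F arbitrary: a E and a E)
    (simp_all add: up_sub_Var up_I_single up_C_single, simp add: single_def)

lemma inst_eq_psub: "inst N M = psub (case_nat N Var) no_stack M"
  by (simp add: inst_def sub_eq_psub)

lemma psub_case_nat_rename: "psub (case_nat N \<tau>) \<theta> (rename Suc id M) = psub \<tau> \<theta> M"
  by (simp add: psub_rename comp_def)

lemma psub_elt_case_nat_lift_I: "psub_elt (case_nat N \<tau>) \<theta> (lift_I E) = psub_elt \<tau> \<theta> E"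
  by (simp add: psub_rename comp_def)

text \<open>Instantiating index \<open>0\<close> cancels the shifts made by \<open>up_sub\<close>
  and \<open>up_I\<close>. In \<open>adequacy\<close> this turns an instantiated binder body into
  the body under an extended valuation, to which the induction hypothesis applies.\<close>

lemma inst_psub: "inst N (psub (up_sub \<tau>) (up_I \<theta>) M) = psub (case_nat N \<tau>) \<theta> M"
proof -
  have 1: "psub (case_nat N Var) no_stack (up_sub \<tau> x) = case_nat N \<tau> x" for x
    by (cases x) (simp_all add: up_sub_def psub_case_nat_rename psub_Var)
  have 2: "comp_st (case_nat N Var) no_stack (up_I \<theta> a) = \<theta> a" for a
    by (simp add: comp_st_def up_I_def psub_elt_case_nat_lift_I psub_Var comp_def)
  show ?thesis by (simp add: inst_eq_psub psub_psub 1 2)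
qed

text \<open>Makes beta and case redexes stable under \<open>psub\<close>: both sides are
  \<open>M\<close> under \<tau> extended by the image of \<open>N\<close>.\<close>

lemma psub_inst: "psub \<tau> \<theta> (inst N M) = inst (psub \<tau> \<theta> N) (psub (up_sub \<tau>) (up_I \<theta>) M)"
proof -
  have "(\<lambda>x. psub \<tau> \<theta> (case_nat N Var x)) = case_nat (psub \<tau> \<theta> N) \<tau>"
    by (auto split: nat.split)
  then show ?thesis unfolding inst_psub
    by (simp add: inst_eq_psub psub_psub comp_st_def)
qed

text \<open>The analogue for mu-redexes. The two composites are compared index by index; at
  \<open>0\<close> both attach the shifted image of \<open>E\<close>.\<close>

lemma psub_csub:
  "psub (\<lambda>x. rename id Suc (\<tau> x)) (up_C \<theta>) (csub 0 (lift_C E) M)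
    = csub 0 (lift_C (psub_elt \<tau> \<theta> E)) (psub (\<lambda>x. rename id Suc (\<tau> x)) (up_C \<theta>) M)"
proof -
  have 1: "comp_st (\<lambda>x. rename id Suc (\<tau> x)) (up_C \<theta>) (single 0 (lift_C E) a)
    = comp_st Var (single 0 (lift_C (psub_elt \<tau> \<theta> E))) (up_C \<theta> a)" for a
  proof (cases a)
    case 0
    then show ?thesis
      by (simp add: comp_st_def single_def psub_up_rename_C) (simp add: up_C_def single_def)
  next
    case (Suc b)
    then show ?thesis
      by (simp add: comp_st_def single_def up_C_def psub_rename)
        (simp add: single_def comp_def rename_eq_psub)
  qed
  \<comment> \<open>After the shift index \<open>0\<close> does not occur, so the replacement at
    \<open>0\<close> has nothing to act on.\<close>
  have 2: "psub Var (single 0 (lift_C (psub_elt \<tau> \<theta> E))) (rename id Suc P) = rename id Suc P" for P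
    by (simp add: psub_rename) (simp add: single_def comp_def rename_eq_psub)
  show ?thesis by (simp add: csub_eq_psub psub_psub 1 2)
qed

section \<open>Stability of reduction under substitution, and reduction of stacks\<close>

lemma red_apps1: "red M M' \<Longrightarrow> red (apps M Es) (apps M' Es)"
  by (induction Es arbitrary: M M') (simp_all add: red_App1)

text \<open>No redex is lost under a substitution, even one that attaches stacks, so one step
  becomes exactly one step. This is what lets SN be reflected from an instance to the term.\<close>

lemma red_psub:
  "red M M' \<Longrightarrow> red (psub \<tau> \<theta> M) (psub \<tau> \<theta> M')"
  "red_elt E E' \<Longrightarrow> red_elt (psub_elt \<tau> \<theta> E) (psub_elt \<tau> \<theta> E')"
proof (induction arbitrary: \<tau> \<theta> and \<tau> \<theta> rule: red_red_elt.inducts)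
  \<comment> \<open>The contracted term now sits in front of the attached stack
    \<open>snd (\<theta> a)\<close>.\<close>
  case (red_Name M M' a)
  then show ?case by (auto intro: red_red_elt.red_Name red_apps1)
qed (auto simp: psub_inst psub_csub psub_up_rename_I intro: red_red_elt.intros)

text \<open>A permutative conversion between two adjacent frames does not look at the head term, so
  it counts as a step of the stack itself.\<close>

inductive red_st :: "elt list \<Rightarrow> elt list \<Rightarrow> bool" where
  st_hd: "red_elt E E' \<Longrightarrow> red_st (E # Es) (E' # Es)"
| st_tl: "red_st Es Es' \<Longrightarrow> red_st (E # Es) (E # Es')"
| st_perm: "red_st (Case N1 N2 # E # Es) (Case (App N1 (lift_I E)) (App N2 (lift_I E)) # Es)"

text \<open>Contraction of a redex formed by a head and the first frame of its stack, kept apart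
  from the steps inside either of them.\<close>

inductive root :: "trm \<Rightarrow> elt \<Rightarrow> trm \<Rightarrow> bool" where
  "root (Lam M) (Arg N) (inst N M)"
| "root (Tup M1 M2) Pi1 M1"
| "root (Tup M1 M2) Pi2 M2"
| "root (In1 M) (Case N1 N2) (inst M N1)"
| "root (In2 M) (Case N1 N2) (inst M N2)"
| "root (App M (Case N1 N2)) E (App M (Case (App N1 (lift_I E)) (App N2 (lift_I E))))"
| "root (Mu M) E (Mu (csub 0 (lift_C E) M))"

inductive_cases red_VarE: "red (Var x) X"
inductive_cases red_LamE: "red (Lam M) X"
inductive_cases red_TupE: "red (Tup M N) X"
inductive_cases red_In1E: "red (In1 M) X"
inductive_cases red_In2E: "red (In2 M) X"
inductive_cases red_MuE: "red (Mu M) X"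
inductive_cases red_NameE: "red (Name a M) X"
inductive_cases red_ArgE: "red_elt (Arg N) X"
inductive_cases red_Pi1E: "red_elt Pi1 X"
inductive_cases red_Pi2E: "red_elt Pi2 X"
inductive_cases red_CaseE: "red_elt (Case N1 N2) X"
inductive_cases red_st_NilE: "red_st [] X"
inductive_cases red_st_ConsE: "red_st (E # Es) X"
inductive_cases root_AppE: "root (App M E) F X"

lemmas red_elims = red_VarE red_LamE red_TupE red_In1E red_In2E red_MuE red_NameE
  red_ArgE red_Pi1E red_Pi2E red_CaseE red_st_NilE

lemma red_App_cases:
  assumes "red (App M E) X"
  obtains "root M E X" | M' where "red M M'" "X = App M' E" | E' where "red_elt E E'" "X = App M E'"
  using assms by (cases rule: red.cases) (auto intro: root.intros)

lemma red_apps2: "red_st Es Es' \<Longrightarrow> red (apps M Es) (apps M Es')"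
  by (induction arbitrary: M rule: red_st.induct) (auto intro: red_red_elt.intros red_apps1)

lemma red_apps_cases:
  assumes "red (apps M Es) X"
  obtains M' where "red M M'" "X = apps M' Es"
    | Es' where "red_st Es Es'" "X = apps M Es'"
    | E Fs Y where "Es = E # Fs" "root M E Y" "X = apps Y Fs"
  using assms
proof (induction Es arbitrary: M thesis)
  case (Cons E Es)
  from Cons.prems(4) have "red (apps (App M E) Es) X" by simp
  then show ?case
  proof (rule Cons.IH[rotated 3])
    fix M' assume M': "red (App M E) M'" "X = apps M' Es"
    from M'(1) show ?case
      by (cases rule: red_App_cases) (use M' Cons.prems(1,2,3) in \<open>force intro: st_hd\<close>)+
  next
    fix Es' assume "red_st Es Es'" "X = apps (App M E) Es'"
    then show ?case using Cons.prems(2)[of "E # Es'"] by (auto intro: st_tl)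
  next
    \<comment> \<open>The head is an application here, so its redex with \<open>F\<close> can only
      be a permutation, and that is a step of the stack \<open>E # F # Fs\<close>.\<close>
    fix F Fs Y assume *: "Es = F # Fs" "root (App M E) F Y" "X = apps Y Fs"
    from *(2) obtain N1 N2 where
      "E = Case N1 N2" "Y = App M (Case (App N1 (lift_I F)) (App N2 (lift_I F)))"
      by (auto elim: root_AppE)
    then show ?case using * Cons.prems(2) by (force intro: st_perm)
  qed
qed auto

lemma red_st_psub: "red_st Es Es' \<Longrightarrow> red_st (map (psub_elt \<tau> \<theta>) Es) (map (psub_elt \<tau> \<theta>) Es')"
  by (induction rule: red_st.induct) (auto intro: red_st.intros red_psub simp: psub_up_rename_I)

lemma red_rename: "red M M' \<Longrightarrow> red (rename r s M) (rename r s M')"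
  by (simp add: rename_eq_psub red_psub)

lemma red_st_rename: "red_st Es Es' \<Longrightarrow> red_st (map (rename_elt r s) Es) (map (rename_elt r s) Es')"
  using red_st_psub[of Es Es' "\<lambda>x. Var (r x)" "\<lambda>a. (s a, [])"] by (simp add: rename_eq_psub[abs_def])

section \<open>Many-step reduction inside substituted terms and stacks\<close>

lemma rtranclp_map:
  assumes "R\<^sup>*\<^sup>* x y" and "\<And>x y. R x y \<Longrightarrow> S (f x) (f y)"
  shows "S\<^sup>*\<^sup>* (f x) (f y)"
  using assms(1) by induction (auto intro: rtranclp.rtrancl_into_rtrancl assms(2))

lemma rtranclp_map2:
  assumes "R\<^sup>*\<^sup>* x y" "R'\<^sup>*\<^sup>* x' y'"
    and "\<And>x y z. R x y \<Longrightarrow> S (f x z) (f y z)" "\<And>x y z. R' x y \<Longrightarrow> S (f z x) (f z y)"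
  shows "S\<^sup>*\<^sup>* (f x x') (f y y')"
  using rtranclp_map[OF assms(1), of S "\<lambda>x. f x x'"] rtranclp_map[OF assms(2), of S "f y"]
    assms(3,4) by (meson rtranclp_trans)

lemma reds_rename: "red\<^sup>*\<^sup>* M M' \<Longrightarrow> red\<^sup>*\<^sup>* (rename r s M) (rename r s M')"
  by (erule rtranclp_map, rule red_rename)

lemma reds_st_rename:
  "red_st\<^sup>*\<^sup>* Es Es' \<Longrightarrow> red_st\<^sup>*\<^sup>* (map (rename_elt r s) Es) (map (rename_elt r s) Es')"
  by (erule rtranclp_map, rule red_st_rename)

lemma reds_apps: "red\<^sup>*\<^sup>* M M' \<Longrightarrow> red_st\<^sup>*\<^sup>* Es Es' \<Longrightarrow> red\<^sup>*\<^sup>* (apps M Es) (apps M' Es')"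
  by (erule (1) rtranclp_map2[where f = apps]; intro red_apps1 red_apps2)

lemma reds_App: "red\<^sup>*\<^sup>* M M' \<Longrightarrow> red_elt\<^sup>*\<^sup>* E E' \<Longrightarrow> red\<^sup>*\<^sup>* (App M E) (App M' E')"
  by (erule (1) rtranclp_map2[where f = App]; intro red_App1 red_App2)

lemma reds_Tup: "red\<^sup>*\<^sup>* M M' \<Longrightarrow> red\<^sup>*\<^sup>* N N' \<Longrightarrow> red\<^sup>*\<^sup>* (Tup M N) (Tup M' N')"
  by (erule (1) rtranclp_map2[where f = Tup]; intro red_Tup1 red_Tup2)

lemma reds_Case: "red\<^sup>*\<^sup>* M M' \<Longrightarrow> red\<^sup>*\<^sup>* N N' \<Longrightarrow> red_elt\<^sup>*\<^sup>* (Case M N) (Case M' N')"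
  by (erule (1) rtranclp_map2[where f = Case]; intro red_Case1 red_Case2)

lemma reds_unary:
  assumes "red\<^sup>*\<^sup>* M M'"
  shows "red\<^sup>*\<^sup>* (Lam M) (Lam M')" "red\<^sup>*\<^sup>* (Mu M) (Mu M')" "red\<^sup>*\<^sup>* (In1 M) (In1 M')"
    "red\<^sup>*\<^sup>* (In2 M) (In2 M')" "red\<^sup>*\<^sup>* (Name a M) (Name a M')" "red_elt\<^sup>*\<^sup>* (Arg M) (Arg M')"
  using assms by (auto elim!: rtranclp_map intro: red_red_elt.intros)

definition reds_env ::
  "(nat \<Rightarrow> trm) \<Rightarrow> (nat \<Rightarrow> nat \<times> elt list) \<Rightarrow> (nat \<Rightarrow> trm) \<Rightarrow> (nat \<Rightarrow> nat \<times> elt list) \<Rightarrow> bool" where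
  "reds_env \<tau> \<theta> \<tau>' \<theta>' \<longleftrightarrow> (\<forall>x. red\<^sup>*\<^sup>* (\<tau> x) (\<tau>' x))
    \<and> (\<forall>a. fst (\<theta> a) = fst (\<theta>' a) \<and> red_st\<^sup>*\<^sup>* (snd (\<theta> a)) (snd (\<theta>' a)))"

lemma reds_env_up_I:
  "reds_env \<tau> \<theta> \<tau>' \<theta>' \<Longrightarrow> reds_env (up_sub \<tau>) (up_I \<theta>) (up_sub \<tau>') (up_I \<theta>')"
  by (auto simp: reds_env_def up_sub_def up_I_def intro: reds_rename reds_st_rename split: nat.split)

lemma reds_env_up_C:
  "reds_env \<tau> \<theta> \<tau>' \<theta>'
    \<Longrightarrow> reds_env (\<lambda>x. rename id Suc (\<tau> x)) (up_C \<theta>) (\<lambda>x. rename id Suc (\<tau>' x)) (up_C \<theta>')"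
  by (auto simp: reds_env_def up_C_def intro: reds_rename reds_st_rename split: nat.split)

text \<open>Many steps are needed because a variable may occur several times in \<open>M\<close>, or
  not at all.\<close>

lemma reds_psub:
  "reds_env \<tau> \<theta> \<tau>' \<theta>' \<Longrightarrow> red\<^sup>*\<^sup>* (psub \<tau> \<theta> M) (psub \<tau>' \<theta>' M)"
  "reds_env \<tau> \<theta> \<tau>' \<theta>' \<Longrightarrow> red_elt\<^sup>*\<^sup>* (psub_elt \<tau> \<theta> E) (psub_elt \<tau>' \<theta>' E)"
proof (induction M and E arbitrary: \<tau> \<theta> \<tau>' \<theta>' and \<tau> \<theta> \<tau>' \<theta>')
  case (Name a M)
  then show ?case by (auto simp: reds_env_def intro!: reds_unary reds_apps)
qed (simp add: reds_env_def, simp_all add: reds_unary reds_App reds_Tup reds_Case reds_env_up_I reds_env_up_C)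

section \<open>Strong normalization as accessibility\<close>

definition sn :: "trm \<Rightarrow> bool" where
  "sn = Wellfounded.accp red\<inverse>\<inverse>"

definition sn_st :: "elt list \<Rightarrow> bool" where
  "sn_st = Wellfounded.accp red_st\<inverse>\<inverse>"

lemma snI: "(\<And>M'. red M M' \<Longrightarrow> sn M') \<Longrightarrow> sn M"
  unfolding sn_def by (rule accpI) auto

lemma sn_red: "sn M \<Longrightarrow> red M M' \<Longrightarrow> sn M'"
  unfolding sn_def by (auto intro: accp_downward)

lemma sn_reds: "red\<^sup>*\<^sup>* M M' \<Longrightarrow> sn M \<Longrightarrow> sn M'"
  by (induction rule: rtranclp_induct) (simp_all add: sn_red)

lemma sn_induct [consumes 1, case_names sn]:
  assumes "sn M" "\<And>M. sn M \<Longrightarrow> (\<And>M'. red M M' \<Longrightarrow> P M') \<Longrightarrow> P M"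
  shows "P M"
  using assms(1) unfolding sn_def
proof (induction rule: accp.induct)
  case (accI M)
  show ?case by (rule assms(2)) (use accI in \<open>auto simp: sn_def intro: accp.accI\<close>)
qed

lemma sn_stI: "(\<And>Es'. red_st Es Es' \<Longrightarrow> sn_st Es') \<Longrightarrow> sn_st Es"
  unfolding sn_st_def by (rule accpI) auto

lemma sn_st_induct [consumes 1, case_names sn_st]:
  assumes "sn_st Es" "\<And>Es. sn_st Es \<Longrightarrow> (\<And>Es'. red_st Es Es' \<Longrightarrow> P Es') \<Longrightarrow> P Es"
  shows "P Es"
  using assms(1) unfolding sn_st_def
proof (induction rule: accp.induct)
  case (accI Es)
  show ?case by (rule assms(2)) (use accI in \<open>auto simp: sn_st_def intro: accp.accI\<close>)
qed

lemma sn_imp_SN: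
  assumes "sn M"
  shows "M \<in> SN"
proof -
  have "\<forall>f. f 0 = M \<longrightarrow> (\<exists>i. \<not> red (f i) (f (Suc i)))" using assms
  proof (induction rule: sn_induct)
    case (sn M)
    show ?case
    proof (intro allI impI, rule ccontr)
      fix f assume f: "f 0 = M" and "\<nexists>i. \<not> red (f i) (f (Suc i))"
      then have r: "\<And>i. red (f i) (f (Suc i))" by auto
      have "red M (f (Suc 0))" using r[of 0] f by simp
      from sn.IH[OF this, rule_format, of "\<lambda>i. f (Suc i)"]
      show False using r by simp
    qed
  qed
  then show ?thesis by (auto simp: SN_def)
qed

text \<open>An infinite reduction of \<open>M\<close> would be carried step by step to one of
  \<open>f M\<close>. The induction runs on the image and ranges over all its preimages.\<close>

lemma sn_of_sn_image:
  assumes "\<And>M M'. red M M' \<Longrightarrow> red (f M) (f M')" and "sn (f M)"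
  shows "sn M"
proof -
  have "\<forall>M. K = f M \<longrightarrow> sn M" if "sn K" for K
    using that
  proof (induction rule: sn_induct)
    case (sn K)
    show ?case
    proof (intro allI impI)
      fix M assume "K = f M"
      then show "sn M" using sn assms(1) by (auto intro: snI)
    qed
  qed
  with assms(2) show ?thesis by auto
qed

lemma sn_of_sn_psub: "sn (psub \<tau> \<theta> M) \<Longrightarrow> sn M"
  by (rule sn_of_sn_image[of "psub \<tau> \<theta>"]) (auto intro: red_psub)

lemma sn_of_sn_inst: "sn (inst N M) \<Longrightarrow> sn M"
  unfolding inst_eq_psub by (rule sn_of_sn_psub)

lemma sn_head: "sn (apps M Es) \<Longrightarrow> sn M"
  by (rule sn_of_sn_image[of "\<lambda>M. apps M Es"]) (auto intro: red_apps1)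

lemma sn_unary:
  assumes "sn M" and "\<And>M X. red (C M) X \<Longrightarrow> \<exists>M'. red M M' \<and> X = C M'"
  shows "sn (C M)"
  using assms(1)
proof (induction rule: sn_induct)
  case (sn M)
  show ?case by (rule snI) (use sn assms(2) in blast)
qed

lemma sn_Lam: "sn M \<Longrightarrow> sn (Lam M)"
  by (erule sn_unary[where C = "Lam"]) (auto elim: red_elims)

lemma sn_In1: "sn M \<Longrightarrow> sn (In1 M)"
  by (erule sn_unary[where C = "In1"]) (auto elim: red_elims)

lemma sn_In2: "sn M \<Longrightarrow> sn (In2 M)"
  by (erule sn_unary[where C = "In2"]) (auto elim: red_elims)

lemma sn_Mu: "sn M \<Longrightarrow> sn (Mu M)"
  by (erule sn_unary[where C = "Mu"]) (auto elim: red_elims)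

lemma sn_Name: "sn M \<Longrightarrow> sn (Name a M)"
  by (erule sn_unary[where C = "Name a"]) (auto elim: red_elims)

lemma sn_Tup:
  assumes "sn M" "sn N"
  shows "sn (Tup M N)"
  using assms
proof (induction arbitrary: N rule: sn_induct)
  case (sn M)
  from sn.prems sn.hyps sn.IH show ?case
  proof (induction N rule: sn_induct)
    case (sn N)
    show ?case by (rule snI) (use sn in \<open>auto elim!: red_TupE\<close>)
  qed
qed

text \<open>
  \<open>Q\<close> is an invariant of the reductions inside head and stack which makes the contracta of the
  redex between them SN.
\<close>

lemma sn_apps:
  assumes "sn M" "sn_st Es" "Q M Es"
    and redM: "\<And>M M' Es. Q M Es \<Longrightarrow> red M M' \<Longrightarrow> Q M' Es"
    and redE: "\<And>M Es Es'. Q M Es \<Longrightarrow> red_st Es Es' \<Longrightarrow> Q M Es'"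
    and root: "\<And>M E Es Y. sn M \<Longrightarrow> sn_st (E # Es) \<Longrightarrow> Q M (E # Es) \<Longrightarrow> root M E Y \<Longrightarrow> sn (apps Y Es)"
  shows "sn (apps M Es)"
  using assms(1-3)
proof (induction arbitrary: Es rule: sn_induct)
  case (sn M)
  note snM = \<open>sn M\<close> and IH = sn.IH
  from sn.prems show ?case
  proof (induction rule: sn_st_induct)
    case (sn_st Es)
    show ?case
    proof (rule snI, erule red_apps_cases)
      fix X M' assume "red M M'" "X = apps M' Es"
      with IH[of M' Es] sn_st redM show "sn X" by blast
    next
      fix X Es' assume "red_st Es Es'" "X = apps M Es'"
      with sn_st redE show "sn X" by blast
    next
      fix X E Fs Y assume "Es = E # Fs" "root M E Y" "X = apps Y Fs"
      with sn_st snM root show "sn X" by blast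
    qed
  qed
qed

text \<open>A variable is normal and forms no redex with a frame, so only stack steps
  remain.\<close>

lemma sn_apps_Var: "sn_st Es \<Longrightarrow> sn (apps (Var x) Es)"
proof (rule sn_apps[where Q = "\<lambda>M Es. M = Var x"])
  show "sn (Var x)" by (rule snI) (auto elim: red_elims)
qed (auto elim: red_elims root.cases)

section \<open>Strongly normalizing stacks\<close>

lemma sn_st_Nil: "sn_st []"
  by (rule sn_stI) (auto elim: red_elims)

text \<open>A first frame other than \<open>Case\<close>, and all its reducts, block the permutation
  at the front, so \<open>E\<close> and \<open>Es\<close> reduce independently. The singleton
  \<open>[E]\<close> expresses SN of the frame alone.\<close>

lemma sn_st_Cons:
  assumes "sn_st Es"
    and "sn_st [E]" and "\<And>N1 N2. E \<noteq> Case N1 N2"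
  shows "sn_st (E # Es)"
proof -
  have "\<forall>E Es. Fs = [E] \<longrightarrow> (\<forall>N1 N2. E \<noteq> Case N1 N2) \<longrightarrow> sn_st Es \<longrightarrow> sn_st (E # Es)" if "sn_st Fs" for Fs
    using that
  proof (induction rule: sn_st_induct)
    case (sn_st Fs)
    show ?case
    proof (intro allI impI)
      fix E Es assume Fs: "Fs = [E]" and E: "\<forall>N1 N2. E \<noteq> Case N1 N2" and Es: "sn_st Es"
      from Es show "sn_st (E # Es)"
      proof (induction Es rule: sn_st_induct)
        case Es: (sn_st Es)
        show ?case
        proof (rule sn_stI, erule red_st_ConsE)
          fix E' X assume X: "X = E' # Es" and r: "red_elt E E'"
          from r E have "\<forall>N1 N2. E' \<noteq> Case N1 N2" by (auto elim: red_elt.cases)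
          with r sn_st(2)[of "[E']"] Fs Es X show "sn_st X" by (auto intro: st_hd)
        qed (use E Es in auto)
      qed
    qed
  qed
  with assms show ?thesis by blast
qed

lemma sn_st_Arg: "sn N \<Longrightarrow> sn_st Es \<Longrightarrow> sn_st (Arg N # Es)"
proof (rule sn_st_Cons)
  show "sn_st [Arg N]" if "sn N" using that
    by (induction rule: sn_induct) (rule sn_stI, auto elim!: red_st_ConsE red_elims)
qed auto

lemma sn_st_Pi: "sn_st Es \<Longrightarrow> sn_st (Pi1 # Es)" "sn_st Es \<Longrightarrow> sn_st (Pi2 # Es)"
  by (rule sn_st_Cons, assumption, rule sn_stI, auto elim!: red_st_ConsE red_elims)+

text \<open>Lexicographic induction on the first assumed SN term, the second one, and the length of
  \<open>Es\<close>. A permutation at the front moves a frame into both branches: the two terms stay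
  the same and \<open>Es\<close> gets shorter. Any other step reduces one of the two terms.\<close>

lemma sn_st_Case:
  assumes "sn (apps N1 (map lift_I Es))" and "sn (apps N2 (map lift_I Es))"
  shows "sn_st (Case N1 N2 # Es)"
proof -
  have "\<forall>K2. sn K2 \<longrightarrow> (\<forall>N1 N2 Es. K1 = apps N1 (map lift_I Es) \<longrightarrow> K2 = apps N2 (map lift_I Es)
      \<longrightarrow> sn_st (Case N1 N2 # Es))" if "sn K1" for K1
    using that
  proof (induction rule: sn_induct)
    case K1: (sn K1)
    have "\<forall>N1 N2 Es. K1 = apps N1 (map lift_I Es) \<longrightarrow> K2 = apps N2 (map lift_I Es)
      \<longrightarrow> sn_st (Case N1 N2 # Es)" if "sn K2" for K2
      using that
    proof (induction rule: sn_induct)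
      case K2: (sn K2)
      have "\<forall>N1 N2. K1 = apps N1 (map lift_I Es) \<longrightarrow> K2 = apps N2 (map lift_I Es)
        \<longrightarrow> sn_st (Case N1 N2 # Es)" for Es
      proof (induction "length Es" arbitrary: Es rule: less_induct)
        case less
        show ?case
        proof (intro allI impI)
          fix N1 N2
          assume eq: "K1 = apps N1 (map lift_I Es)" "K2 = apps N2 (map lift_I Es)"
          show "sn_st (Case N1 N2 # Es)"
          proof (rule sn_stI, erule red_st_ConsE)
            fix X E' assume X: "X = E' # Es" and "red_elt (Case N1 N2) E'"
            from this(2) show "sn_st X"
            proof (rule red_CaseE)
              fix N1' assume "E' = Case N1' N2" "red N1 N1'"
              with K1 K2(1) eq X show ?thesis by (blast intro: red_apps1)
            next
              fix N2' assume "E' = Case N1 N2'" "red N2 N2'"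
              with K2 eq X show ?thesis by (blast intro: red_apps1)
            qed
          next
            \<comment> \<open>A step in \<open>Es\<close> reduces both terms at once; the outer
              hypothesis applies, and SN of the second reduct comes from
              \<open>sn_red\<close>.\<close>
            fix X Es' assume X: "X = Case N1 N2 # Es'" and r: "red_st Es Es'"
            have "red_st (map lift_I Es) (map lift_I Es')" using r by (rule red_st_rename)
            then have "red K1 (apps N1 (map lift_I Es'))" "red K2 (apps N2 (map lift_I Es'))"
              using eq by (auto intro: red_apps2)
            with K1 K2(1) X show "sn_st X" by (blast intro: sn_red)
          next
            \<comment> \<open>The frame \<open>E\<close> changes sides, but the branches applied to
              their lifted stacks are still \<open>K1\<close> and \<open>K2\<close>.\<close>
            fix X M1 M2 E Fs
            assume "Case N1 N2 = Case M1 M2" "Es = E # Fs"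
              "X = Case (App M1 (lift_I E)) (App M2 (lift_I E)) # Fs"
            with less[of Fs] eq show "sn_st X" by auto
          qed
        qed
      qed
      then show ?case by blast
    qed
    then show ?case by blast
  qed
  with assms show ?thesis by blast
qed

section \<open>Head expansion: a redex in front of a stack is SN when its contractum is\<close>

lemma red_inst1: "red M M' \<Longrightarrow> red (inst N M) (inst N M')"
  unfolding inst_eq_psub by (rule red_psub)

lemma reds_inst2: "red N N' \<Longrightarrow> red\<^sup>*\<^sup>* (inst N M) (inst N' M)"
  unfolding inst_eq_psub by (rule reds_psub) (auto simp: reds_env_def split: nat.split)

lemma sn_inst_red: "sn (apps (inst N M) Es) \<Longrightarrow> red N N' \<Longrightarrow> sn (apps (inst N' M) Es)"
  by (erule sn_reds[rotated], rule rtranclp_map[OF reds_inst2]) (auto intro: red_apps1)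

text \<open>SN of \<open>M\<close> is reflected from the contractum, but \<open>inst N M\<close> may
  discard \<open>N\<close>, whose SN is therefore assumed separately.\<close>

lemma sn_Lam_Arg:
  assumes "sn (apps (inst N M) Es)" "sn N" "sn_st Es"
  shows "sn (apps (Lam M) (Arg N # Es))"
proof (rule sn_apps[where Q = "\<lambda>M Es. \<exists>P N Fs. M = Lam P \<and> Es = Arg N # Fs \<and> sn (apps (inst N P) Fs)"])
  show "sn (Lam M)"
    using assms(1) by (rule sn_Lam[OF sn_of_sn_inst[OF sn_head]])
  show "sn_st (Arg N # Es)" using assms by (simp add: sn_st_Arg)
next
  fix M M' Es assume "\<exists>P N Fs. M = Lam P \<and> Es = Arg N # Fs \<and> sn (apps (inst N P) Fs)" "red M M'"
  then show "\<exists>P N Fs. M' = Lam P \<and> Es = Arg N # Fs \<and> sn (apps (inst N P) Fs)"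
    by (auto elim!: red_LamE dest: sn_red[OF _ red_apps1[OF red_inst1]])
next
  fix M Es Es' assume "\<exists>P N Fs. M = Lam P \<and> Es = Arg N # Fs \<and> sn (apps (inst N P) Fs)" "red_st Es Es'"
  then show "\<exists>P N Fs. M = Lam P \<and> Es' = Arg N # Fs \<and> sn (apps (inst N P) Fs)"
    by (auto elim!: red_st_ConsE red_ArgE intro: sn_inst_red dest: sn_red[OF _ red_apps2])
qed (use assms in \<open>auto elim!: root.cases\<close>)

text \<open>The component erased by the projection has to be SN by assumption.\<close>

lemma sn_Tup_Pi1:
  assumes "sn (apps M Es)" "sn N" "sn_st Es"
  shows "sn (apps (Tup M N) (Pi1 # Es))"
proof (rule sn_apps[where Q = "\<lambda>M Es. \<exists>P N Fs. M = Tup P N \<and> Es = Pi1 # Fs \<and> sn (apps P Fs)"])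
  show "sn (Tup M N)"
    using sn_head[OF assms(1)] assms(2) by (rule sn_Tup)
  show "sn_st (Pi1 # Es)" using assms by (simp add: sn_st_Pi)
next
  fix M M' Es assume "\<exists>P N Fs. M = Tup P N \<and> Es = Pi1 # Fs \<and> sn (apps P Fs)" "red M M'"
  then show "\<exists>P N Fs. M' = Tup P N \<and> Es = Pi1 # Fs \<and> sn (apps P Fs)"
    by (auto elim!: red_TupE dest: sn_red[OF _ red_apps1])
next
  fix M Es Es' assume "\<exists>P N Fs. M = Tup P N \<and> Es = Pi1 # Fs \<and> sn (apps P Fs)" "red_st Es Es'"
  then show "\<exists>P N Fs. M = Tup P N \<and> Es' = Pi1 # Fs \<and> sn (apps P Fs)"
    by (auto elim!: red_st_ConsE red_Pi1E dest: sn_red[OF _ red_apps2])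
qed (use assms in \<open>auto elim!: root.cases\<close>)

lemma sn_Tup_Pi2:
  assumes "sn (apps N Es)" "sn M" "sn_st Es"
  shows "sn (apps (Tup M N) (Pi2 # Es))"
proof (rule sn_apps[where Q = "\<lambda>M Es. \<exists>P N Fs. M = Tup P N \<and> Es = Pi2 # Fs \<and> sn (apps N Fs)"])
  show "sn (Tup M N)"
    using assms(2) sn_head[OF assms(1)] by (rule sn_Tup)
  show "sn_st (Pi2 # Es)" using assms by (simp add: sn_st_Pi)
next
  fix M M' Es assume "\<exists>P N Fs. M = Tup P N \<and> Es = Pi2 # Fs \<and> sn (apps N Fs)" "red M M'"
  then show "\<exists>P N Fs. M' = Tup P N \<and> Es = Pi2 # Fs \<and> sn (apps N Fs)"
    by (auto elim!: red_TupE dest: sn_red[OF _ red_apps1])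
next
  fix M Es Es' assume "\<exists>P N Fs. M = Tup P N \<and> Es = Pi2 # Fs \<and> sn (apps N Fs)" "red_st Es Es'"
  then show "\<exists>P N Fs. M = Tup P N \<and> Es' = Pi2 # Fs \<and> sn (apps N Fs)"
    by (auto elim!: red_st_ConsE red_Pi2E dest: sn_red[OF _ red_apps2])
qed (use assms in \<open>auto elim!: root.cases\<close>)

text \<open>A frame that a permutation moved into a branch reappears in front of the remaining stack
  once the branch is instantiated. Contracta of case redexes thus survive permutations
  unchanged.\<close>

lemma inst_App_lift_I: "inst M (App N (lift_I E)) = App (inst M N) E"
  by (simp add: inst_eq_psub psub_elt_case_nat_lift_I psub_Var)

text \<open>The branch \<open>N2\<close> is absent from the contractum; SN of the stack including
  its \<open>Case\<close> frame controls it.\<close>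

lemma sn_In1_Case:
  assumes "sn (apps (inst M N1) Es)" "sn M" "sn_st (Case N1 N2 # Es)"
  shows "sn (apps (In1 M) (Case N1 N2 # Es))"
proof (rule sn_apps[where Q = "\<lambda>M Es. \<exists>P N1 N2 Fs. M = In1 P \<and> Es = Case N1 N2 # Fs
    \<and> sn (apps (inst P N1) Fs)"])
  show "sn (In1 M)"
    using assms(2) by (rule sn_In1)
next
  fix M M' Es
  assume "\<exists>P N1 N2 Fs. M = In1 P \<and> Es = Case N1 N2 # Fs \<and> sn (apps (inst P N1) Fs)" "red M M'"
  then show "\<exists>P N1 N2 Fs. M' = In1 P \<and> Es = Case N1 N2 # Fs \<and> sn (apps (inst P N1) Fs)"
    by (auto elim!: red_In1E intro: sn_inst_red)
next
  fix M Es Es'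
  assume "\<exists>P N1 N2 Fs. M = In1 P \<and> Es = Case N1 N2 # Fs \<and> sn (apps (inst P N1) Fs)" "red_st Es Es'"
  then show "\<exists>P N1 N2 Fs. M = In1 P \<and> Es' = Case N1 N2 # Fs \<and> sn (apps (inst P N1) Fs)"
    by (auto elim!: red_st_ConsE red_CaseE simp: inst_App_lift_I
        dest: sn_red[OF _ red_apps2] sn_red[OF _ red_apps1[OF red_inst1]])
qed (use assms in \<open>auto elim!: root.cases\<close>)

lemma sn_In2_Case:
  assumes "sn (apps (inst M N2) Es)" "sn M" "sn_st (Case N1 N2 # Es)"
  shows "sn (apps (In2 M) (Case N1 N2 # Es))"
proof (rule sn_apps[where Q = "\<lambda>M Es. \<exists>P N1 N2 Fs. M = In2 P \<and> Es = Case N1 N2 # Fs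
    \<and> sn (apps (inst P N2) Fs)"])
  show "sn (In2 M)"
    using assms(2) by (rule sn_In2)
next
  fix M M' Es
  assume "\<exists>P N1 N2 Fs. M = In2 P \<and> Es = Case N1 N2 # Fs \<and> sn (apps (inst P N2) Fs)" "red M M'"
  then show "\<exists>P N1 N2 Fs. M' = In2 P \<and> Es = Case N1 N2 # Fs \<and> sn (apps (inst P N2) Fs)"
    by (auto elim!: red_In2E intro: sn_inst_red)
next
  fix M Es Es'
  assume "\<exists>P N1 N2 Fs. M = In2 P \<and> Es = Case N1 N2 # Fs \<and> sn (apps (inst P N2) Fs)" "red_st Es Es'"
  then show "\<exists>P N1 N2 Fs. M = In2 P \<and> Es' = Case N1 N2 # Fs \<and> sn (apps (inst P N2) Fs)"
    by (auto elim!: red_st_ConsE red_CaseE simp: inst_App_lift_I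
        dest: sn_red[OF _ red_apps2] sn_red[OF _ red_apps1[OF red_inst1]])
qed (use assms in \<open>auto elim!: root.cases\<close>)

text \<open>The body of a \<open>Mu\<close> after successive mu-steps have absorbed the whole stack
  \<open>Es\<close>; its variable \<open>0\<close> stays bound by that \<open>Mu\<close>.\<close>

definition cinst :: "elt list \<Rightarrow> trm \<Rightarrow> trm" where
  "cinst Es = psub Var (case_nat (0, map lift_C Es) (\<lambda>b. (Suc b, [])))"

lemma red_cinst1: "red M M' \<Longrightarrow> red (cinst Es M) (cinst Es M')"
  unfolding cinst_def by (rule red_psub)

lemma reds_cinst2: "red_st Es Es' \<Longrightarrow> red\<^sup>*\<^sup>* (cinst Es M) (cinst Es' M)"
  unfolding cinst_def by (rule reds_psub) (auto simp: reds_env_def split: nat.split intro: red_st_rename)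

text \<open>One mu-step consumes one frame without changing the fully absorbed body, which makes
  that body an invariant for \<open>sn_apps_Mu\<close>.\<close>

lemma cinst_csub: "cinst Es (csub 0 (lift_C E) M) = cinst (E # Es) M"
proof -
  let ?\<theta> = "\<lambda>Es. case_nat (0, map lift_C Es) (\<lambda>b. (Suc b, []))"
  \<comment> \<open>The shifted frame does not contain index \<open>0\<close>, so a frame already
    absorbed receives no further stack.\<close>
  have "psub_elt Var (?\<theta> Es) (lift_C E) = lift_C E"
    by (simp add: psub_rename comp_def) (simp add: rename_eq_psub)
  then have "comp_st Var (?\<theta> Es) (single 0 (lift_C E) a) = ?\<theta> (E # Es) a" for a
    by (auto simp: comp_st_def single_def split: nat.split)
  then show ?thesis by (simp only: cinst_def csub_eq_psub psub_psub psub.simps(1))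
qed

text \<open>Renaming the mu-variable to \<open>k\<close> turns the absorbed body into the body under
  a valuation extended by \<open>(k, Es)\<close>. This connects \<open>sn_apps_Mu\<close> with the
  induction hypothesis in \<open>adequacy\<close>.\<close>

lemma psub_cinst:
  "psub Var (case_nat (k, []) no_stack)
      (cinst Es (psub (\<lambda>x. rename id Suc (\<tau> x)) (up_C \<theta>) M))
    = psub \<tau> (case_nat (k, Es) \<theta>) M"
proof -
  let ?\<rho> = "case_nat (k, []) no_stack"
  let ?\<theta> = "case_nat (0, map lift_C Es) (\<lambda>b. (Suc b, []))"
  have 1: "psub Var ?\<rho> (rename id Suc P) = P" "psub_elt Var ?\<rho> (lift_C E) = E" for P E
    by (simp_all add: psub_rename comp_def psub_Var)
  have 2: "psub Var ?\<theta> (rename id Suc P) = rename id Suc P" "psub_elt Var ?\<theta> (lift_C E) = lift_C E"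
    for P E by (simp_all add: psub_rename comp_def) (simp_all add: rename_eq_psub)
  have "comp_st Var ?\<rho> (comp_st Var ?\<theta> (up_C \<theta> a)) = case_nat (k, Es) \<theta> a" for a
    by (auto simp: comp_st_def up_C_def 1 2 comp_def split: nat.split)
  then show ?thesis by (simp add: cinst_def psub_psub 1 2)
qed

lemma red_st_length: "red_st Es Es' \<Longrightarrow> length Es' \<le> length Es"
  by (induction rule: red_st.induct) auto

text \<open>A mu-step yields a \<open>Mu\<close> with the same absorbed body and one frame fewer,
  whence the induction on the length of the stack.\<close>

lemma sn_apps_Mu: "sn (cinst Es M) \<Longrightarrow> sn_st Es \<Longrightarrow> sn (apps (Mu M) Es)"
proof (induction "length Es" arbitrary: M Es rule: less_induct)
  case less
  \<comment> \<open>The invariant only bounds the length by \<open>?n\<close>, because a permutation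
    inside the stack shortens it.\<close>
  let ?n = "length Es"
  show ?case
  proof (rule sn_apps[where Q = "\<lambda>M Es. \<exists>P. M = Mu P \<and> length Es \<le> ?n \<and> sn (cinst Es P)"])
    show "sn (Mu M)"
      using less.prems(1) unfolding cinst_def by (rule sn_Mu[OF sn_of_sn_psub])
  next
    fix M M' Es assume "\<exists>P. M = Mu P \<and> length Es \<le> ?n \<and> sn (cinst Es P)" "red M M'"
    then show "\<exists>P. M' = Mu P \<and> length Es \<le> ?n \<and> sn (cinst Es P)"
      by (auto elim!: red_MuE dest: sn_red[OF _ red_cinst1])
  next
    fix M Es Es' assume "\<exists>P. M = Mu P \<and> length Es \<le> ?n \<and> sn (cinst Es P)" "red_st Es Es'"
    then show "\<exists>P. M = Mu P \<and> length Es' \<le> ?n \<and> sn (cinst Es' P)"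
      by (fastforce intro: sn_reds[OF reds_cinst2] dest: red_st_length)
  next
    fix M E Es Y
    assume Q: "\<exists>P. M = Mu P \<and> length (E # Es) \<le> ?n \<and> sn (cinst (E # Es) P)"
      and "root M E Y" and st: "sn_st (E # Es)"
    then obtain P where P: "M = Mu P" "Y = Mu (csub 0 (lift_C E) P)" "length Es < ?n"
      "sn (cinst Es (csub 0 (lift_C E) P))"
      by (auto elim!: root.cases simp: cinst_csub)
    have "sn_st Fs \<Longrightarrow> \<forall>E Es. Fs = E # Es \<longrightarrow> sn_st Es" for Fs
    proof (induction rule: sn_st_induct)
      case (sn_st Fs)
      then show ?case by (blast intro: sn_stI st_tl)
    qed
    with st have "sn_st Es" by blast
    with P less.hyps show "sn (apps Y Es)" by blast
  qed (use less.prems in auto)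
qed

section \<open>Interpretation of formulas by stacks, and adequacy\<close>

definition orth :: "elt list set \<Rightarrow> trm set" where
  "orth S = {M. \<forall>Es\<in>S. sn (apps M Es)}"

text \<open>The empty stack is in every clause, so that realizers are themselves SN.\<close>

primrec stacks :: "'p form \<Rightarrow> elt list set" where
  "stacks (Atom p) = {[]}"
| "stacks Bot = {[]}"
| "stacks (Imp A B) = insert [] {Arg N # Es |N Es. N \<in> orth (stacks A) \<and> Es \<in> stacks B}"
| "stacks (Conj A B) = insert [] ({Pi1 # Es |Es. Es \<in> stacks A} \<union> {Pi2 # Es |Es. Es \<in> stacks B})"
| "stacks (Disj A B) = insert [] {Case N1 N2 # Es |N1 N2 Es.
    (\<forall>P\<in>orth (stacks A). sn (apps (inst P N1) Es)) \<and> (\<forall>P\<in>orth (stacks B). sn (apps (inst P N2) Es))}"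

lemma Nil_in_stacks: "[] \<in> stacks A"
  by (cases A) auto

lemma sn_orth_stacks: "M \<in> orth (stacks A) \<Longrightarrow> sn M"
  using Nil_in_stacks[of A] by (force simp: orth_def)

lemma inst_apps_lift_I: "inst M (apps N (map lift_I Es)) = apps (inst M N) Es"
  by (induction Es arbitrary: N) (simp_all add: inst_App_lift_I)

lemma sn_st_Case_stacks:
  assumes "sn (apps (inst P N1) Es)" "sn (apps (inst Q N2) Es)"
  shows "sn_st (Case N1 N2 # Es)"
  by (rule sn_st_Case; rule sn_of_sn_inst; subst inst_apps_lift_I; rule assms)

text \<open>For a disjunction the defining condition only concerns branches instantiated by
  realizers, so it yields nothing until some realizer is known. \<open>Var 0\<close> is one for both
  disjuncts, by the induction hypotheses.\<close>

lemma sn_st_stacks: "Es \<in> stacks A \<Longrightarrow> sn_st Es"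
proof (induction A arbitrary: Es)
  case (Disj A B)
  have "Var 0 \<in> orth (stacks A)" "Var 0 \<in> orth (stacks B)"
    using Disj.IH by (auto simp: orth_def intro: sn_apps_Var)
  with Disj.prems show ?case by (auto intro: sn_st_Nil sn_st_Case_stacks)
qed (auto intro: sn_st_Nil sn_st_Arg sn_st_Pi sn_orth_stacks)

lemma Var_in_orth: "Var x \<in> orth (stacks A)"
  by (auto simp: orth_def intro: sn_apps_Var sn_st_stacks)

text \<open>Only the stack part of \<theta> is constrained; the target names are free, as naming a
  term does not affect its SN.\<close>

lemma adequacy:
  assumes "has_type \<Gamma> \<Delta> M A"
    and "\<And>x. x < length \<Gamma> \<Longrightarrow> \<tau> x \<in> orth (stacks (\<Gamma> ! x))"
    and "\<And>a. a < length \<Delta> \<Longrightarrow> snd (\<theta> a) \<in> stacks (\<Delta> ! a)"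
  shows "psub \<tau> \<theta> M \<in> orth (stacks A)"
  using assms
proof (induction arbitrary: \<tau> \<theta> rule: has_type.induct)
  case (ty_tup \<Gamma> \<Delta> M A N B)
  then have MN: "psub \<tau> \<theta> M \<in> orth (stacks A)" "psub \<tau> \<theta> N \<in> orth (stacks B)" by blast+
  have "sn (apps (Tup (psub \<tau> \<theta> M) (psub \<tau> \<theta> N)) Es)" if "Es \<in> stacks (Conj A B)" for Es
    using that MN[THEN sn_orth_stacks] MN
    by (auto simp: orth_def simp del: apps_simps(2)
        intro: sn_Tup sn_Tup_Pi1 sn_Tup_Pi2 sn_st_stacks)
  then show ?case by (simp add: orth_def del: stacks.simps)
next
  case (ty_pi1 \<Gamma> \<Delta> M A B)
  then have "psub \<tau> \<theta> M \<in> orth (stacks (Conj A B))" by blast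
  then show ?case by (force simp: orth_def)
next
  case (ty_pi2 \<Gamma> \<Delta> M A B)
  then have "psub \<tau> \<theta> M \<in> orth (stacks (Conj A B))" by blast
  then show ?case by (force simp: orth_def)
next
  case (ty_lam A \<Gamma> \<Delta> M B)
  have *: "inst N (psub (up_sub \<tau>) (up_I \<theta>) M) \<in> orth (stacks B)" if "N \<in> orth (stacks A)" for N
    unfolding inst_psub using that ty_lam.prems
    by (intro ty_lam.IH) (auto split: nat.split simp: nth_Cons)
  \<comment> \<open>Against the empty stack there is no redex at the head, so the body itself must
    be SN: it is instantiated with a variable, which is a realizer, and SN is reflected.\<close>
  have "sn (psub (up_sub \<tau>) (up_I \<theta>) M)"
    using sn_of_sn_inst sn_orth_stacks[OF *[OF Var_in_orth]] .
  then have "sn (apps (Lam (psub (up_sub \<tau>) (up_I \<theta>) M)) Es)" if "Es \<in> stacks (Imp A B)" for Es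
    using that * sn_orth_stacks[of _ A] sn_st_stacks[of _ B]
    by (auto simp: orth_def[of "stacks B"] simp del: apps_simps(2) intro: sn_Lam intro!: sn_Lam_Arg)
  then show ?case by (simp add: orth_def del: stacks.simps)
next
  case (ty_app \<Gamma> \<Delta> M A B N)
  then have "psub \<tau> \<theta> M \<in> orth (stacks (Imp A B))" "psub \<tau> \<theta> N \<in> orth (stacks A)" by blast+
  then show ?case by (force simp: orth_def)
next
  case (ty_in1 \<Gamma> \<Delta> M A B)
  then have M: "psub \<tau> \<theta> M \<in> orth (stacks A)" by blast
  have "sn (apps (In1 (psub \<tau> \<theta> M)) Es)" if "Es \<in> stacks (Disj A B)" for Es
    using that sn_st_stacks[OF that] sn_orth_stacks[OF M] M
    by (auto simp del: apps_simps(2) intro: sn_In1 intro!: sn_In1_Case)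
  then show ?case by (simp add: orth_def del: stacks.simps)
next
  case (ty_in2 \<Gamma> \<Delta> M B A)
  then have M: "psub \<tau> \<theta> M \<in> orth (stacks B)" by blast
  have "sn (apps (In2 (psub \<tau> \<theta> M)) Es)" if "Es \<in> stacks (Disj A B)" for Es
    using that sn_st_stacks[OF that] sn_orth_stacks[OF M] M
    by (auto simp del: apps_simps(2) intro: sn_In2 intro!: sn_In2_Case)
  then show ?case by (simp add: orth_def del: stacks.simps)
next
  case (ty_case \<Gamma> \<Delta> M A B N1 C N2)
  let ?N = "psub (up_sub \<tau>) (up_I \<theta>)"
  have M: "psub \<tau> \<theta> M \<in> orth (stacks (Disj A B))" using ty_case by blast
  have "inst P (?N N1) \<in> orth (stacks C)" if "P \<in> orth (stacks A)" for P
    unfolding inst_psub using that ty_case.prems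
    by (intro ty_case.IH) (auto split: nat.split simp: nth_Cons)
  moreover have "inst P (?N N2) \<in> orth (stacks C)" if "P \<in> orth (stacks B)" for P
    unfolding inst_psub using that ty_case.prems
    by (intro ty_case.IH) (auto split: nat.split simp: nth_Cons)
  \<comment> \<open>Adequacy of the two branches is exactly the condition on a disjunction stack,
    for every tail taken from the stacks of \<open>C\<close>.\<close>
  ultimately have "Case (?N N1) (?N N2) # Es \<in> stacks (Disj A B)" if "Es \<in> stacks C" for Es
    using that by (auto simp: orth_def)
  with M have "sn (apps (psub \<tau> \<theta> M) (Case (?N N1) (?N N2) # Es))" if "Es \<in> stacks C" for Es
    using that unfolding orth_def by blast
  then show ?case by (simp add: orth_def del: stacks.simps)
next
  case (ty_mu \<Gamma> A \<Delta> M)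
  let ?M = "psub (\<lambda>x. rename id Suc (\<tau> x)) (up_C \<theta>) M"
  have "sn (cinst Es ?M)" if "Es \<in> stacks A" for Es
  proof -
    \<comment> \<open>The target \<open>0\<close> is an arbitrary choice. It may identify the
      mu-variable with a free one, which is harmless because SN is reflected along every
      substitution.\<close>
    let ?\<theta> = "case_nat (0, Es) \<theta>"
    have "sn (psub \<tau> ?\<theta> M)"
      by (rule sn_orth_stacks[OF ty_mu.IH])
        (use that ty_mu.prems in \<open>auto split: nat.split simp: nth_Cons\<close>)
    then have "sn (psub Var (case_nat (0, []) no_stack) (cinst Es ?M))"
      by (simp add: psub_cinst)
    then show ?thesis by (rule sn_of_sn_psub)
  qed
  then show ?case
    by (auto simp: orth_def intro!: sn_apps_Mu sn_st_stacks)
next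
  case (ty_name a \<Delta> \<Gamma> M)
  then have "psub \<tau> \<theta> M \<in> orth (stacks (\<Delta> ! a))" "snd (\<theta> a) \<in> stacks (\<Delta> ! a)" by blast+
  then show ?case by (auto simp: orth_def intro: sn_Name)
qed auto

theorem theorem4p3:
  fixes \<Gamma> \<Delta> :: "'p form list" and A B :: "'p form"
    and M :: trm and \<sigma> :: "nat \<rightharpoonup> trm"
  assumes "has_type \<Gamma> \<Delta> M B" and "M \<in> SN"
    and "finite (dom \<sigma>)"
    and "\<And>x. x \<in> dom \<sigma> \<Longrightarrow> x < length \<Gamma> \<and> \<Gamma> ! x = A"
    and "\<And>N. N \<in> ran \<sigma> \<Longrightarrow> \<exists>\<Gamma>' \<Delta>'. has_type \<Gamma>' \<Delta>' N A"
    and "\<And>N. N \<in> ran \<sigma> \<Longrightarrow> N \<in> SN"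
  shows "msub \<sigma> M \<in> SN"
proof -
  have N: "N \<in> orth (stacks A)" if "N \<in> ran \<sigma>" for N
  proof -
    from assms(5)[OF that] obtain \<Gamma>' \<Delta>' where "has_type \<Gamma>' \<Delta>' N A" by blast
    \<comment> \<open>The identity valuation is admissible in any context, since variables realize
      every formula and \<open>[]\<close> is among its stacks.\<close>
    from adequacy[OF this, of Var no_stack] show ?thesis
      by (simp add: Var_in_orth Nil_in_stacks psub_Var)
  qed
  \<comment> \<open>Variables in the domain of \<sigma> have type \<open>A\<close> and receive
    realizers of \<open>A\<close>; the others stay variables and realize any formula.\<close>
  have "(case \<sigma> x of None \<Rightarrow> Var x | Some N \<Rightarrow> N) \<in> orth (stacks (\<Gamma> ! x))" for x
    using N assms(4)[of x] by (auto simp: Var_in_orth domI ranI split: option.split)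
  from adequacy[OF assms(1) this, of no_stack] have "msub \<sigma> M \<in> orth (stacks B)"
    by (simp add: Nil_in_stacks msub_def sub_eq_psub)
  then show ?thesis by (rule sn_imp_SN[OF sn_orth_stacks])
qed

end
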